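(* Let $C \in M_n$ be a non-scalar matrix and let $\mathcal{F} \subseteq M_n$ be non-empty. (a) If $U \in M_n$ is unitary, then $W_C(\mathcal{F}) = W_C(U^*\mathcal{F}U)$, where $U^*\mathcal{F}U = \{U^*AU : A \in \mathcal{F}\}$. (b) For any $\alpha,\beta \in \mathbb{C}$, let $\alpha\mathcal{F}+\beta I = \{\alpha A+\beta I : A \in \mathcal{F}\}$. Then $W_C(\alpha\mathcal{F}+\beta I) = \alpha W_C(\mathcal{F}) + \beta\,\mathrm{tr}\,C = \{\alpha\mu+\beta\,\mathrm{tr}\,C : \mu \in W_C(\mathcal{F})\}$. (c) If $\mathcal{F}$ is bounded, then so is $W_C(\mathcal{F})$. (d) If $\mathcal{F}$ is connected, then so is $W_C(\mathcal{F})$. (e) If $\mathcal{F}$ is compact, then so is $W_C(\mathcal{F})$.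
   Context: $M_n$ is the set of $n\times n$ complex matrices with its usual topology. For $C, A \in M_n$, the $C$-numerical range of $A$ is $W_C(A) = \{\mathrm{tr}(CU^*AU) : U \in M_n \text{ unitary}\} \subseteq \mathbb{C}$. For a non-empty $\mathcal{F}\subseteq M_n$, $W_C(\mathcal{F}) = \bigcup\{W_C(A) : A \in \mathcal{F}\}$. *)

theory Defs
  imports "HOL-Analysis.Analysis"
begin

definition conj_transpose :: "complex^'n^'m \<Rightarrow> complex^'m^'n"
  where "conj_transpose A = (\<chi> i j. cnj (A $ j $ i))"

(* Both equations are required, as in the library's orthogonal_matrix. *)
definition unitary_matrix :: "complex^'n^'n \<Rightarrow> bool"
  where "unitary_matrix U \<longleftrightarrow>
    conj_transpose U ** U = mat 1 \<and> U ** conj_transpose U = mat 1"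

definition scalar_matrix :: "complex^'n^'n \<Rightarrow> bool"
  where "scalar_matrix C \<longleftrightarrow> (\<exists>c. C = mat c)"

(* Entrywise multiplication by a complex scalar: scaleR only covers real scalars,
   and the product * on vectors is componentwise. *)
definition cscale_matrix :: "complex \<Rightarrow> complex^'n^'m \<Rightarrow> complex^'n^'m"
  where "cscale_matrix \<alpha> A = (\<chi> i j. \<alpha> * A $ i $ j)"

definition C_numerical_range :: "complex^'n^'n \<Rightarrow> complex^'n^'n \<Rightarrow> complex set"
  where "C_numerical_range C A =
    {trace (C ** conj_transpose U ** A ** U) | U. unitary_matrix U}"

definition C_numerical_range_family :: "complex^'n^'n \<Rightarrow> (complex^'n^'n) set \<Rightarrow> complex set"
  where "C_numerical_range_family C F = (\<Union>A\<in>F. C_numerical_range C A)"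

end

theory Submission
  imports Defs
begin

text \<open>The map \<open>(A, U) \<mapsto> tr (C U\<^sup>* A U)\<close> is continuous and \<open>W\<^sub>C(\<F>)\<close> is its image on the product of
  \<open>\<F>\<close> and the unitary group, so it suffices that the unitary group is compact and connected. For
  connectedness, a unitary \<open>V\<close> is joined to a unimodular scalar matrix \<open>b\<^sub>0 I\<close> by the Moebius
  transforms \<open>(b I + V) (I + cnj b V)\<^sup>-\<^sup>1\<close> with \<open>b\<close> running from \<open>0\<close> to \<open>b\<^sub>0\<close>, where \<open>- b\<^sub>0\<close> is chosen
  outside the finite spectrum of \<open>V\<close>; the unimodular scalar matrices form a circle.\<close>

section \<open>Matrix algebra with scalar matrices and conjugate transposes\<close>

lemma matrix_mult_nth: "(A ** B) $ i $ j = (\<Sum>k\<in>UNIV. A $ i $ k * B $ k $ j)"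
  by (simp add: matrix_matrix_mult_def)

lemma matrix_add_rdistrib: "(A + B) ** C = A ** C + B ** C"
  by (simp add: vec_eq_iff matrix_mult_nth distrib_right sum.distrib)

lemma matrix_mult_matrix_inv:
  assumes "invertible A"
  shows "A ** matrix_inv A = mat 1"
  using assms unfolding invertible_def matrix_inv_def by (metis (mono_tags, lifting) someI_ex)

lemma conj_transpose_mult: "conj_transpose (A ** B) = conj_transpose B ** conj_transpose A"
  by (simp add: conj_transpose_def matrix_matrix_mult_def vec_eq_iff mult.commute)

lemma conj_transpose_conj_transpose [simp]: "conj_transpose (conj_transpose A) = A"
  by (simp add: conj_transpose_def vec_eq_iff)

lemma conj_transpose_add: "conj_transpose (A + B) = conj_transpose A + conj_transpose B"
  by (simp add: conj_transpose_def vec_eq_iff)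

lemma conj_transpose_mat [simp]: "conj_transpose (mat c) = mat (cnj c)"
  by (auto simp: conj_transpose_def mat_def vec_eq_iff)

lemma mat_mult_nth: "(mat c ** A) $ i $ j = c * A $ i $ j"
  by (simp add: matrix_matrix_mult_def mat_def mult_delta_left)

lemma mult_mat_nth: "(A ** mat c) $ i $ j = A $ i $ j * c"
  by (simp add: matrix_matrix_mult_def mat_def mult_delta_right)

lemma mat_mult_commute: "mat c ** A = A ** mat (c::'a::comm_semiring_1)"
  by (simp add: vec_eq_iff mat_mult_nth mult_mat_nth mult.commute)

lemma mat_mult_mat: "mat a ** mat b = mat (a * b)"
  unfolding vec_eq_iff mat_mult_nth by (simp add: mat_def)

lemma mat_mult_vec: "mat c *v x = c *s x"
  by (simp add: vec_eq_iff matrix_vector_mult_def mat_def mult_delta_left)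

text \<open>Turns scalar multiples into products with the matrices \<open>mat c\<close>, which
  commute with every square matrix, so that all later rearrangements take place in the matrix
  ring.\<close>

lemma cscale_matrix_eq_mat_mult: "cscale_matrix c A = mat c ** A"
  by (simp add: vec_eq_iff cscale_matrix_def mat_mult_nth)

lemma trace_mat_mult: "trace (mat c ** A) = c * trace A"
  by (simp add: trace_def mat_mult_nth sum_distrib_left)

lemma norm_vector_smult: "norm (c *s x) = norm c * norm x"
  for x :: "complex^'n"
  by (simp add: norm_vec_def L2_set_right_distrib norm_mult)

lemma cnj_mult_self_unit: "norm z = 1 \<Longrightarrow> cnj z * z = 1"
  by (metis complex_norm_square mult.commute of_real_1 one_power2)

section \<open>Unitary matrices and their eigenvalues\<close>

lemma unitary_matrix_iff: "unitary_matrix U \<longleftrightarrow> conj_transpose U ** U = mat 1"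
  unfolding unitary_matrix_def using matrix_left_right_inverse by blast

lemma unitary_matrix_mult:
  assumes "unitary_matrix U" "unitary_matrix V"
  shows "unitary_matrix (U ** V)"
  using assms unfolding unitary_matrix_iff
  by (metis conj_transpose_mult matrix_mul_assoc matrix_mul_rid)

lemma unitary_matrix_conj_transpose: "unitary_matrix U \<Longrightarrow> unitary_matrix (conj_transpose U)"
  by (simp add: unitary_matrix_def)

lemma unitary_matrix_mat: "norm c = 1 \<Longrightarrow> unitary_matrix (mat c)"
  by (simp add: unitary_matrix_iff mat_mult_mat cnj_mult_self_unit)

text \<open>The library's \<open>inner\<close> on complex vectors is real valued; it is the real
  part of this sesquilinear form. Complex eigenvalues can be pulled out only from the full form,
  which is conjugate linear in the first argument.\<close>

definition hermitian_inner :: "complex^'n \<Rightarrow> complex^'n \<Rightarrow> complex"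
  where "hermitian_inner x y = (\<Sum>i\<in>UNIV. cnj (x $ i) * y $ i)"

lemma Re_hermitian_inner: "Re (hermitian_inner x y) = inner x y"
  by (simp add: hermitian_inner_def inner_vec_def inner_complex_def)

lemma hermitian_inner_smult:
  "hermitian_inner (a *s x) (b *s y) = cnj a * b * hermitian_inner x y"
  by (simp add: hermitian_inner_def sum_distrib_left ac_simps)

lemma hermitian_inner_matrix:
  "hermitian_inner (A *v x) y = hermitian_inner x (conj_transpose A *v y)"
proof -
  have "hermitian_inner (A *v x) y = (\<Sum>i\<in>UNIV. \<Sum>j\<in>UNIV. cnj (A $ i $ j) * cnj (x $ j) * y $ i)"
    by (simp add: hermitian_inner_def matrix_vector_mult_def sum_distrib_right)
  also have "\<dots> = (\<Sum>j\<in>UNIV. \<Sum>i\<in>UNIV. cnj (A $ i $ j) * cnj (x $ j) * y $ i)"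
    by (rule sum.swap)
  also have "\<dots> = hermitian_inner x (conj_transpose A *v y)"
    by (simp add: hermitian_inner_def matrix_vector_mult_def sum_distrib_left conj_transpose_def
        ac_simps)
  finally show ?thesis .
qed

lemma hermitian_inner_unitary:
  assumes "unitary_matrix V"
  shows "hermitian_inner (V *v x) (V *v y) = hermitian_inner x y"
  using assms by (simp add: hermitian_inner_matrix matrix_vector_mul_assoc unitary_matrix_iff)

lemma norm_unitary:
  assumes "unitary_matrix V"
  shows "norm (V *v x) = norm x"
  by (metis Re_hermitian_inner assms hermitian_inner_unitary norm_eq_sqrt_inner)

text \<open>\<open>V\<close> preserves the Hermitian form, so its value h at \<open>x\<close>,
  \<open>y\<close> satisfies h = \<open>cnj a * b\<close> h. The factor differs from 1 because
  \<open>a\<close> is unimodular and \<open>b\<close> is another number, hence h = 0. The conclusion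
  is about the real part, as the library's orthogonality is.\<close>

lemma unitary_eigenvectors_orthogonal:
  assumes V: "unitary_matrix V" and "V *v x = a *s x" "V *v y = b *s y"
    and "norm a = 1" "a \<noteq> b"
  shows "inner x y = 0"
proof -
  have "hermitian_inner x y = cnj a * b * hermitian_inner x y"
    using hermitian_inner_unitary[OF V, of x y] assms by (simp add: hermitian_inner_smult)
  moreover have "cnj a * b \<noteq> 1"
  proof
    assume "cnj a * b = 1"
    then have "(cnj a * a) * b = a"
      by (simp add: ac_simps)
    with assms show False
      by (simp add: cnj_mult_self_unit)
  qed
  ultimately have "hermitian_inner x y = 0"
    by auto
  then show ?thesis
    by (metis Re_hermitian_inner zero_complex.sel(1))
qed

text \<open>One eigenvector is chosen for each eigenvalue. These are nonzero and pairwise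
  orthogonal, hence independent over the reals, and an independent set in a finite-dimensional space
  is finite. No characteristic polynomial enters. The condition \<open>norm z = 1\<close> feeds the
  orthogonality lemma.\<close>

lemma finite_unitary_eigenvalues:
  assumes V: "unitary_matrix V"
  shows "finite {z. norm z = 1 \<and> (\<exists>x. x \<noteq> 0 \<and> V *v x = z *s x)}" (is "finite ?E")
proof -
  have "\<forall>z\<in>?E. \<exists>x. x \<noteq> 0 \<and> V *v x = z *s x"
    by blast
  then obtain f where f: "\<And>z. z \<in> ?E \<Longrightarrow> f z \<noteq> 0 \<and> V *v f z = z *s f z"
    unfolding bchoice_iff by blast
  have orth: "inner (f z) (f w) = 0" if "z \<in> ?E" "w \<in> ?E" "z \<noteq> w" for z w
    using unitary_eigenvectors_orthogonal[OF V] f that by blast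
  have "inj_on f ?E"
  proof (rule inj_onI, rule ccontr)
    fix z w
    assume zw: "z \<in> ?E" "w \<in> ?E" "f z = f w" "z \<noteq> w"
    then show False
      using orth[OF zw(1,2,4)] f[OF zw(1)] by simp
  qed
  moreover have "independent (f ` ?E)"
  proof (rule pairwise_orthogonal_independent)
    show "pairwise orthogonal (f ` ?E)"
      unfolding pairwise_def orthogonal_def using orth by (metis (no_types, lifting) imageE)
    show "0 \<notin> f ` ?E"
      using f by (metis (no_types, lifting) imageE)
  qed
  ultimately show ?thesis
    using finiteI_independent finite_imageD by blast
qed

text \<open>A finite connected set has at most one point, but the circle is connected and contains
  both 1 and -1.\<close>

lemma infinite_unit_circle: "infinite {z::complex. norm z = 1}"
proof
  assume fin: "finite {z::complex. norm z = 1}"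
  have "{z::complex. norm z = 1} = sphere 0 1"
    by auto
  then have "connected {z::complex. norm z = 1}"
    using connected_sphere[of "0::complex" 1] by simp
  then have "(1::complex) = -1"
    using fin connected_finite_iff_sing[of "{z::complex. norm z = 1}"]
    by (metis (mono_tags, lifting) empty_iff mem_Collect_eq norm_minus_cancel norm_one singletonD)
  then show False
    by simp
qed

section \<open>Continuity of the matrix operations\<close>

lemma continuous_on_matrix_matrix_mult [continuous_intros]:
  fixes f :: "'a::topological_space \<Rightarrow> 'b::{real_normed_algebra, semiring_1}^'n^'m"
    and g :: "'a \<Rightarrow> 'b^'k^'n"
  assumes "continuous_on S f" "continuous_on S g"
  shows "continuous_on S (\<lambda>x. f x ** g x)"
  unfolding matrix_matrix_mult_def by (intro continuous_intros assms)

lemma continuous_on_conj_transpose [continuous_intros]: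
  "continuous_on S f \<Longrightarrow> continuous_on S (\<lambda>x. conj_transpose (f x))"
  unfolding conj_transpose_def by (intro continuous_intros)

lemma continuous_on_mat [continuous_intros]:
  fixes f :: "'a::topological_space \<Rightarrow> 'b::{topological_space, zero}"
  assumes "continuous_on S f"
  shows "continuous_on S (\<lambda>x. mat (f x) :: 'b^'n^'n)"
proof -
  have "continuous_on S (\<lambda>x. if i = j then f x else 0)" for i j :: 'n
    using assms by (cases "i = j") auto
  then show ?thesis
    unfolding mat_def by (intro continuous_intros)
qed

lemma continuous_on_trace [continuous_intros]:
  fixes f :: "'a::topological_space \<Rightarrow> 'b::{real_normed_algebra, semiring_1}^'n^'n"
  assumes "continuous_on S f"
  shows "continuous_on S (\<lambda>x. trace (f x))"
  unfolding trace_def by (intro continuous_intros assms)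

lemma continuous_on_det [continuous_intros]:
  fixes f :: "'a::topological_space \<Rightarrow> 'b::{real_normed_algebra, comm_ring_1}^'n^'n"
  assumes "continuous_on S f"
  shows "continuous_on S (\<lambda>x. det (f x))"
  unfolding det_def by (intro continuous_intros assms)

text \<open>Column \<open>l\<close> of the inverse solves the linear system with right-hand side the
  \<open>l\<close>-th unit vector, so Cramer's rule applies. Entries become quotients of
  determinants, whence inversion is continuous.\<close>

lemma matrix_inv_cramer:
  fixes A :: "'a::field^'n^'n"
  assumes "invertible A"
  shows "matrix_inv A =
    (\<chi> k l. det (\<chi> i j. if j = k then mat 1 $ i $ l else A $ i $ j) / det A)"
proof -
  have "matrix_inv A $ k $ l = det (\<chi> i j. if j = k then mat 1 $ i $ l else A $ i $ j) / det A"
    for k l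
  proof -
    have "A ** matrix_inv A = mat 1"
      using assms by (rule matrix_mult_matrix_inv)
    then have "A *v column l (matrix_inv A) = column l (mat 1)"
      unfolding vec_eq_iff
      by (simp add: matrix_vector_mult_def column_def flip: matrix_mult_nth)
    then have "column l (matrix_inv A) =
        (\<chi> k. det (\<chi> i j. if j = k then column l (mat 1) $ i else A $ i $ j) / det A)"
      using cramer assms invertible_det_nz by blast
    then show ?thesis
      by (simp add: vec_eq_iff column_def cong: if_cong)
  qed
  then show ?thesis
    by (simp add: vec_eq_iff)
qed

lemma continuous_on_matrix_inv [continuous_intros]:
  fixes f :: "'a::topological_space \<Rightarrow> 'b::{real_normed_field}^'n^'n"
  assumes "continuous_on S f" and inv: "\<And>x. x \<in> S \<Longrightarrow> invertible (f x)"
  shows "continuous_on S (\<lambda>x. matrix_inv (f x))"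
proof -
  have entry: "continuous_on S (\<lambda>x. if j = k then mat 1 $ i $ l else f x $ i $ j)"
    for i j k l
    using assms(1) by (cases "j = k") (simp_all add: continuous_on_component)
  have "continuous_on S (\<lambda>x. \<chi> k l.
      det (\<chi> i j. if j = k then mat 1 $ i $ l else f x $ i $ j) / det (f x))"
    using inv
    by (intro continuous_on_vec_lambda continuous_on_divide continuous_on_det entry assms(1)) (auto simp: invertible_det_nz)
  then show ?thesis
    by (rule continuous_on_eq) (simp add: matrix_inv_cramer inv)
qed

section \<open>Compactness of the unitary group\<close>

lemma compact_unitary_matrices: "compact {U::complex^'n^'n. unitary_matrix U}"
proof -
  have "closed {U::complex^'n^'n. unitary_matrix U}"
    unfolding unitary_matrix_iff by (intro closed_Collect_eq continuous_intros)
  moreover have "bounded {U::complex^'n^'n. unitary_matrix U}"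
  proof (rule boundedI)
    fix U :: "complex^'n^'n"
    assume "U \<in> {U. unitary_matrix U}"
    then have U: "U ** conj_transpose U = mat 1"
      by (simp add: unitary_matrix_def)
    \<comment> \<open>The diagonal entries of \<open>U ** conj_transpose U\<close> are the squared
      norms of the rows of \<open>U\<close>.\<close>
    have "norm (U $ i) = 1" for i
    proof -
      have "(U ** conj_transpose U) $ i $ i = of_real (\<Sum>j\<in>UNIV. (norm (U $ i $ j))\<^sup>2)"
        by (simp add: matrix_mult_nth conj_transpose_def complex_norm_square del: of_real_power)
      also have "(U ** conj_transpose U) $ i $ i = 1"
        by (simp add: U mat_def)
      finally have "(\<Sum>j\<in>UNIV. (norm (U $ i $ j))\<^sup>2) = 1"
        by (metis of_real_eq_1_iff)
      then show ?thesis
        by (simp add: norm_vec_def L2_set_def)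
    qed
    \<comment> \<open>The norm of \<open>U\<close> is the Euclidean norm of the vector of row norms,
      hence at most their sum.\<close>
    then show "norm U \<le> real CARD('n)"
      using L2_set_le_sum[of UNIV "\<lambda>i. norm (U $ i)"] by (simp add: norm_vec_def)
  qed
  ultimately show ?thesis
    by (simp add: compact_eq_bounded_closed)
qed

section \<open>Connectedness of the unitary group\<close>

definition moebius_matrix :: "complex^'n^'n \<Rightarrow> complex \<Rightarrow> complex^'n^'n"
  where "moebius_matrix V b = (mat b + V) ** matrix_inv (mat 1 + mat (cnj b) ** V)"

text \<open>Numerator \<open>Q\<close> and denominator \<open>P\<close> have the same Gram matrix:
  both products expand to the same four terms once \<open>conj_transpose V ** V = mat 1\<close> is
  used. Hence \<open>Q ** matrix_inv P\<close> has the Gram matrix of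
  \<open>P ** matrix_inv P\<close>, the identity.\<close>

lemma unitary_moebius_matrix:
  fixes V :: "complex^'n^'n"
  assumes V: "unitary_matrix V" and inv: "invertible (mat 1 + mat (cnj b) ** V)"
  shows "unitary_matrix (moebius_matrix V b)"
proof -
  define P Q where "P = mat 1 + mat (cnj b) ** V" and "Q = mat b + V"
  have R: "P ** matrix_inv P = mat 1"
    using inv unfolding P_def by (rule matrix_mult_matrix_inv)
  have V': "conj_transpose V ** V = mat 1"
    using V by (simp add: unitary_matrix_iff)
  have "conj_transpose V ** mat b ** (mat (cnj b) ** V)
      = mat (b * cnj b) ** (conj_transpose V ** V)"
    by (metis mat_mult_commute mat_mult_mat matrix_mul_assoc)
  then have VV: "conj_transpose V ** mat b ** (mat (cnj b) ** V) = mat (b * cnj b)"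
    by (simp add: V')
  have QP: "conj_transpose Q ** Q = conj_transpose P ** P"
    unfolding P_def Q_def
    by (simp add: conj_transpose_add conj_transpose_mult matrix_add_ldistrib matrix_add_rdistrib
        V' VV mat_mult_mat mult.commute)
  have "conj_transpose (X ** matrix_inv P) ** (X ** matrix_inv P)
      = conj_transpose (matrix_inv P) ** (conj_transpose X ** X) ** matrix_inv P"
    for X :: "complex^'n^'n"
    by (simp add: conj_transpose_mult matrix_mul_assoc)
  from this[of Q] this[of P] have "conj_transpose (Q ** matrix_inv P) ** (Q ** matrix_inv P)
      = conj_transpose (P ** matrix_inv P) ** (P ** matrix_inv P)"
    by (simp only: QP)
  then show ?thesis
    by (simp add: unitary_matrix_iff moebius_matrix_def R flip: P_def Q_def)
qed

lemma unitary_connected_to_scalar: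
  fixes V :: "complex^'n^'n"
  assumes V: "unitary_matrix V"
  obtains S b where "connected S" "S \<subseteq> {U. unitary_matrix U}" "V \<in> S" "mat b \<in> S" "norm b = 1"
proof -
  \<comment> \<open>Only finitely many points of the infinite unit circle are eigenvalues of
    \<open>V\<close>.\<close>
  obtain b' where b': "norm b' = 1" "\<nexists>x. x \<noteq> 0 \<and> V *v x = b' *s x"
    using finite_unitary_eigenvalues[OF V] infinite_unit_circle
    by (smt (verit) Collect_cong)
  define b where "b = - b'"
  have nb: "norm b = 1"
    using b' by (simp add: b_def)
  \<comment> \<open>The kernel is trivial along the whole segment: inside the unit disc because
    \<open>V\<close> is isometric, and at the end \<open>c = b\<close> by the choice of
    \<open>b'\<close>.\<close>
  have inv: "invertible (mat 1 + mat (cnj c) ** V)" if c: "c \<in> closed_segment 0 b" for c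
    unfolding invertible_left_inverse matrix_left_invertible_ker
  proof (intro allI impI)
    fix x
    assume "(mat 1 + mat (cnj c) ** V) *v x = 0"
    then have eq: "x + cnj c *s (V *v x) = 0"
      by (simp add: matrix_vector_mult_add_rdistrib mat_mult_vec flip: matrix_vector_mul_assoc)
    obtain t where t: "0 \<le> t" "t \<le> 1" "c = of_real t * b"
      using c by (auto simp: in_segment scaleR_conv_of_real)
    show "x = 0"
    proof (cases "t = 1")
      case True
      \<comment> \<open>Multiplying the kernel equation by \<open>b\<close> and using
        \<open>b * cnj b = 1\<close> turns it into the eigenvalue equation for \<open>- b\<close>,
        that is, for \<open>b'\<close>.\<close>
      have "b *s x + (b * cnj b) *s (V *v x) = b *s (x + cnj c *s (V *v x))"
        by (simp add: t True vector_add_ldistrib vector_smult_assoc)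
      then have "b *s x + V *v x = 0"
        using cnj_mult_self_unit[OF nb] eq by (simp add: mult.commute)
      then have "V *v x = b' *s x"
        by (simp add: b_def vec_eq_iff)
      then show ?thesis
        using b' by blast
    next
      case False
      \<comment> \<open>The resulting identity \<open>norm x = t * norm x\<close> with
        \<open>t \<noteq> 1\<close> forces \<open>x = 0\<close>.\<close>
      have "norm x = norm (cnj c *s (V *v x))"
        using eq by (metis add_eq_0_iff norm_minus_cancel)
      also have "\<dots> = t * norm x"
        using t nb by (simp add: norm_vector_smult norm_unitary[OF V] norm_mult)
      finally show ?thesis
        using False by simp
    qed
  qed
  show thesis
  proof
    show "connected (moebius_matrix V ` closed_segment 0 b)"
      unfolding moebius_matrix_def
      by (intro connected_continuous_image continuous_intros inv connected_segment)
    show "moebius_matrix V ` closed_segment 0 b \<subseteq> {U. unitary_matrix U}"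
      using unitary_moebius_matrix[OF V] inv by blast
    have "matrix_inv (mat 1) = (mat 1 :: complex^'n^'n)"
      using matrix_mult_matrix_inv[of "mat 1 :: complex^'n^'n"]
      by (simp add: invertible_right_inverse)
    then have "moebius_matrix V 0 = V"
      by (simp add: moebius_matrix_def)
    then show "V \<in> moebius_matrix V ` closed_segment 0 b"
      by (metis ends_in_segment(1) imageI)
    \<comment> \<open>For unimodular \<open>b\<close> the numerator is \<open>b\<close> times the
      denominator, so the transform collapses to a scalar matrix.\<close>
    have "mat b + V = mat b ** (mat 1 + mat (cnj b) ** V)"
      using cnj_mult_self_unit[OF nb]
      by (simp add: matrix_add_ldistrib matrix_mul_assoc mat_mult_mat mult.commute)
    moreover have "(mat 1 + mat (cnj b) ** V) ** matrix_inv (mat 1 + mat (cnj b) ** V) = mat 1"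
      using inv[OF ends_in_segment(2)] by (rule matrix_mult_matrix_inv)
    ultimately have "moebius_matrix V b = mat b"
      unfolding moebius_matrix_def by (metis matrix_mul_assoc matrix_mul_rid)
    then show "mat b \<in> moebius_matrix V ` closed_segment 0 b"
      by (metis ends_in_segment(2) imageI)
    show "norm b = 1"
      by (fact nb)
  qed
qed

text \<open>Every \<open>V\<close> shares a connected set of unitary matrices with some
  \<open>mat b\<close>, and \<open>mat b\<close> shares the circle \<open>?Z\<close> with
  \<open>mat 1\<close>. All unitary matrices thus lie in the component of the identity.\<close>

lemma connected_unitary_matrices: "connected {U::complex^'n^'n. unitary_matrix U}"
proof -
  let ?G = "{U::complex^'n^'n. unitary_matrix U}"
  let ?Z = "(mat :: complex \<Rightarrow> complex^'n^'n) ` sphere 0 1"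
  have Z: "connected ?Z"
    by (intro connected_continuous_image continuous_intros connected_sphere) simp
  have ZG: "?Z \<subseteq> ?G"
    using unitary_matrix_mat by auto
  have "connected_component ?G V (mat 1)" if "V \<in> ?G" for V
  proof -
    from that have "unitary_matrix V"
      by simp
    then obtain S b where "connected S" "S \<subseteq> ?G" "V \<in> S" "mat b \<in> S" "norm b = 1"
      by (rule unitary_connected_to_scalar)
    then have "connected_component ?G V (mat b)" "connected_component ?G (mat b) (mat 1)"
      unfolding connected_component_def using Z ZG by (blast, intro exI[of _ ?Z]) auto
    then show ?thesis
      by (rule connected_component_trans)
  qed
  then show ?thesis
    unfolding connected_iff_connected_component
    by (meson connected_component_sym connected_component_trans)
qed

section \<open>Compactness, connectedness and boundedness of the range\<close>

lemma C_numerical_range_family_eq_image: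
  "C_numerical_range_family C F =
    (\<lambda>(A, U). trace (C ** conj_transpose U ** A ** U)) ` (F \<times> {U. unitary_matrix U})"
  unfolding C_numerical_range_family_def C_numerical_range_def by auto

lemma continuous_on_trace_unitary_conj:
  "continuous_on S (\<lambda>(A, U). trace (C ** conj_transpose U ** A ** U))"
  for C :: "complex^'n^'n"
  unfolding case_prod_unfold by (intro continuous_intros)

lemma compact_C_numerical_range_family: "compact F \<Longrightarrow> compact (C_numerical_range_family C F)"
  unfolding C_numerical_range_family_eq_image
  by (intro compact_continuous_image continuous_on_trace_unitary_conj compact_Times
      compact_unitary_matrices)

lemma connected_C_numerical_range_family:
  "connected F \<Longrightarrow> connected (C_numerical_range_family C F)"
  unfolding C_numerical_range_family_eq_image
  by (intro connected_continuous_image continuous_on_trace_unitary_conj connected_Times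
      connected_unitary_matrices)

text \<open>The closure of a bounded family is compact, and the range grows with the family, so the
  compact case applies.\<close>

lemma bounded_C_numerical_range_family:
  assumes "bounded F"
  shows "bounded (C_numerical_range_family C F)"
proof -
  have "C_numerical_range_family C F \<subseteq> C_numerical_range_family C (closure F)"
    unfolding C_numerical_range_family_def using closure_subset by blast
  moreover have "bounded (C_numerical_range_family C (closure F))"
    using assms by (intro compact_imp_bounded compact_C_numerical_range_family) simp
  ultimately show ?thesis
    by (rule bounded_subset[rotated])
qed

section \<open>Unitary invariance and affine maps\<close>

lemma C_numerical_range_unitary_conj_subset:
  assumes "unitary_matrix U"
  shows "C_numerical_range C (conj_transpose U ** A ** U) \<subseteq> C_numerical_range C A"
proof
  fix z
  assume "z \<in> C_numerical_range C (conj_transpose U ** A ** U)"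
  then obtain V where V: "unitary_matrix V"
    and "z = trace (C ** conj_transpose V ** (conj_transpose U ** A ** U) ** V)"
    unfolding C_numerical_range_def by auto
  \<comment> \<open>The conjugation by \<open>U\<close> is absorbed into the unitary parameter,
    which becomes \<open>U ** V\<close>.\<close>
  then have "z = trace (C ** conj_transpose (U ** V) ** A ** (U ** V))"
    by (simp add: conj_transpose_mult matrix_mul_assoc)
  then show "z \<in> C_numerical_range C A"
    unfolding C_numerical_range_def using unitary_matrix_mult[OF assms V] by blast
qed

text \<open>The reverse inclusion is the same inclusion for \<open>conj_transpose U\<close>, which
  undoes the conjugation.\<close>

lemma C_numerical_range_unitary_conj:
  assumes U: "unitary_matrix U"
  shows "C_numerical_range C (conj_transpose U ** A ** U) = C_numerical_range C A"
proof (rule antisym[OF C_numerical_range_unitary_conj_subset[OF U]])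
  have "conj_transpose (conj_transpose U) ** (conj_transpose U ** A ** U) ** conj_transpose U
      = (U ** conj_transpose U) ** A ** (U ** conj_transpose U)"
    by (simp add: matrix_mul_assoc)
  also have "\<dots> = A"
    using U by (simp add: unitary_matrix_def)
  finally show "C_numerical_range C A \<subseteq> C_numerical_range C (conj_transpose U ** A ** U)"
    using C_numerical_range_unitary_conj_subset[OF unitary_matrix_conj_transpose[OF U]] by metis
qed

text \<open>Scalar matrices move to the front; in the \<beta> term \<open>conj_transpose U\<close>
  then meets \<open>U\<close> and cancels, leaving \<beta> times the trace of
  \<open>C\<close>.\<close>

lemma trace_unitary_conj_affine:
  assumes "unitary_matrix U"
  shows "trace (C ** conj_transpose U ** (cscale_matrix \<alpha> A + mat \<beta>) ** U) =
    \<alpha> * trace (C ** conj_transpose U ** A ** U) + \<beta> * trace C"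
proof -
  have "C ** conj_transpose U ** (mat \<alpha> ** A) ** U = mat \<alpha> ** (C ** conj_transpose U ** A ** U)"
    by (metis mat_mult_commute matrix_mul_assoc)
  moreover have "C ** conj_transpose U ** mat \<beta> ** U = mat \<beta> ** (C ** (conj_transpose U ** U))"
    by (metis mat_mult_commute matrix_mul_assoc)
  ultimately show ?thesis
    using assms
    by (simp add: cscale_matrix_eq_mat_mult matrix_add_ldistrib matrix_add_rdistrib trace_add
        trace_mat_mult unitary_matrix_iff)
qed

lemma C_numerical_range_affine:
  "C_numerical_range C (cscale_matrix \<alpha> A + mat \<beta>) =
    (\<lambda>\<mu>. \<alpha> * \<mu> + \<beta> * trace C) ` C_numerical_range C A"
  unfolding C_numerical_range_def setcompr_eq_image image_image
  by (rule image_cong) (simp_all add: trace_unitary_conj_affine)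

theorem theorem2p3:
  fixes C :: "complex^'n^'n" and F :: "(complex^'n^'n) set"
  assumes "\<not> scalar_matrix C" and "F \<noteq> {}"
  shows
    "(\<forall>U. unitary_matrix U \<longrightarrow>
        C_numerical_range_family C F =
        C_numerical_range_family C {conj_transpose U ** A ** U | A. A \<in> F}) \<and>
     (\<forall>\<alpha> \<beta>.
        C_numerical_range_family C {cscale_matrix \<alpha> A + mat \<beta> | A. A \<in> F} =
        {\<alpha> * \<mu> + \<beta> * trace C | \<mu>. \<mu> \<in> C_numerical_range_family C F}) \<and>
     (bounded F \<longrightarrow> bounded (C_numerical_range_family C F)) \<and>
     (connected F \<longrightarrow> connected (C_numerical_range_family C F)) \<and>
     (compact F \<longrightarrow> compact (C_numerical_range_family C F))"
proof (intro conjI allI impI bounded_C_numerical_range_family connected_C_numerical_range_family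
    compact_C_numerical_range_family)
  \<comment> \<open>The rules given to \<open>intro\<close> reduce the three topological claims to
    their own hypotheses; the two algebraic ones follow member by member from the results for a
    single matrix.\<close>
  fix U :: "complex^'n^'n"
  assume "unitary_matrix U"
  then show "C_numerical_range_family C F =
      C_numerical_range_family C {conj_transpose U ** A ** U | A. A \<in> F}"
    by (simp add: C_numerical_range_family_def setcompr_eq_image C_numerical_range_unitary_conj)
next
  fix \<alpha> \<beta>
  show "C_numerical_range_family C {cscale_matrix \<alpha> A + mat \<beta> | A. A \<in> F} =
      {\<alpha> * \<mu> + \<beta> * trace C | \<mu>. \<mu> \<in> C_numerical_range_family C F}"
    unfolding C_numerical_range_family_def setcompr_eq_image
    by (auto simp: C_numerical_range_affine)
qed

end
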